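(* Let $k\ge1$ be an integer and let $q,z\in\mathbb{C}$ with $|q|<1$ and $z\ne0$. Then $$\sum_{n_1\ge\cdots\ge n_k\ge0}\frac{(-q/z,-zq,-q)_{n_k}\,q^{\sum_{i=1}^{k}\binom{n_i+1}{2}}}{(q)_{n_1-n_2}\cdots(q)_{n_{k-1}-n_k}(q)_{2n_k+1}}=\frac{(-q)_\infty(-q^{k+1}/z,-zq^{k+1},q^{k+1};q^{k+1})_\infty}{(q)_\infty}.$$
   Context: $(a;p)_n=\prod_{j=1}^{n}(1-ap^{j-1})$ for $n\ge0$ (with $(a;p)_0=1$), $(a;p)_\infty=\prod_{j\ge0}(1-ap^j)$, $(a_1,\dots,a_m;p)_n=\prod_i(a_i;p)_n$ and likewise with $n=\infty$; when the base is omitted it is $q$. The sum is over integers $n_1\ge\cdots\ge n_k\ge0$; for $k=1$ the product $(q)_{n_1-n_2}\cdots(q)_{n_{k-1}-n_k}$ is empty and equals $1$. *)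

theory Defs
  imports "HOL-Analysis.Analysis" "HOL-Library.FuncSet"
begin

definition qpoch :: "complex \<Rightarrow> complex \<Rightarrow> nat \<Rightarrow> complex" where
  "qpoch a p n = (\<Prod>j=1..n. 1 - a * p ^ (j - 1))"

text \<open>For \<open>norm p < 1\<close> the product below converges for every \<open>a\<close>; \<^const>\<open>prodinf\<close> also
  has the expected value 0 when some factor vanishes.\<close>

definition qpoch_inf :: "complex \<Rightarrow> complex \<Rightarrow> complex" where
  "qpoch_inf a p = (\<Prod>j. 1 - a * p ^ j)"

text \<open>The multi-parameter symbols \<open>(a\<^sub>1, \<dots>, a\<^sub>m; p)\<^sub>n\<close> and \<open>(a\<^sub>1, \<dots>, a\<^sub>m; p)\<^sub>\<infinity>\<close>.\<close>

definition qpochs :: "complex list \<Rightarrow> complex \<Rightarrow> nat \<Rightarrow> complex" where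
  "qpochs as p n = (\<Prod>a\<leftarrow>as. qpoch a p n)"

definition qpochs_inf :: "complex list \<Rightarrow> complex \<Rightarrow> complex" where
  "qpochs_inf as p = (\<Prod>a\<leftarrow>as. qpoch_inf a p)"

text \<open>Index tuples \<open>n\<^sub>1 \<ge> \<dots> \<ge> n\<^sub>k \<ge> 0\<close>, as functions on \<open>{1..k}\<close>. They are extensional, so that
  each tuple is represented by exactly one function.\<close>

definition decr_tuples :: "nat \<Rightarrow> (nat \<Rightarrow> nat) set" where
  "decr_tuples k = {n \<in> {1..k} \<rightarrow>\<^sub>E UNIV. \<forall>i\<in>{1..<k}. n i \<ge> n (i + 1)}"

end

theory Submission
  imports Defs
begin

text \<open>
  Pairing the terms \<open>j\<close> and \<open>- 1 - j\<close> of the finite Jacobi triple product exhibits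
  \<open>\<beta>\<^sub>n = (- q / z, - z q)\<^sub>n / (q)\<^bsub>2n+1\<^esub>\<close> as \<open>\<Sum>\<^sub>j \<alpha>\<^sub>j / ((q)\<^bsub>n-j\<^esub> (q)\<^bsub>n+j+1\<^esub>)\<close> with
  \<open>\<alpha>\<^sub>j\<close> equal to \<open>q\<close> to the power \<open>j (j + 1) / 2\<close> times a Laurent polynomial in \<open>z\<close> that does not
  depend on \<open>q\<close>. By the \<open>q\<close>-Chu--Vandermonde sum, each of the \<open>k\<close> summations of the multiple sum
  multiplies \<open>\<alpha>\<^sub>j\<close> by a further \<open>q\<close> to the power \<open>j (j + 1) / 2\<close>. What remains is a theta series in
  base \<open>q\<close> to the power \<open>k + 1\<close>, and it is summed by the limit \<open>n \<rightarrow> \<infinity>\<close> of the same finite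
  triple product in that base.
\<close>

section \<open>Finite q-Pochhammer symbols\<close>

lemma qpoch_conv_prod: "qpoch a p n = (\<Prod>j<n. 1 - a * p ^ j)"
  unfolding qpoch_def by (rule prod.reindex_bij_witness[of _ Suc "\<lambda>j. j - 1"]) auto

lemma qpoch_0 [simp]: "qpoch a p 0 = 1"
  by (simp add: qpoch_conv_prod)

lemma qpoch_Suc: "qpoch a p (Suc n) = qpoch a p n * (1 - a * p ^ n)"
  by (simp add: qpoch_conv_prod)

lemma qpoch_add: "qpoch a p (m + n) = qpoch a p m * qpoch (a * p ^ m) p n"
  by (induction n) (simp_all add: qpoch_Suc power_add mult_ac)

lemma qpoch_Suc': "qpoch a p (Suc n) = (1 - a) * qpoch (a * p) p n"
  using qpoch_add[of a p 1 n] by (simp add: qpoch_Suc)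

lemma power_neq_1_of_norm_less_1:
  fixes p :: complex
  assumes "norm p < 1" "n > 0"
  shows "p ^ n \<noteq> 1"
proof
  assume "p ^ n = 1"
  then have "norm p ^ n = 1"
    by (metis norm_one norm_power)
  then show False
    using power_less_one_iff[of "norm p" n] assms by simp
qed

lemma qpoch_self_nonzero: "norm p < 1 \<Longrightarrow> qpoch p p n \<noteq> 0"
  using power_neq_1_of_norm_less_1[of p "Suc _"] by (auto simp: qpoch_conv_prod)

lemma choose_two_Suc: "Suc n choose 2 = (n choose 2) + n"
  by (simp add: numeral_2_eq_2)

lemma choose_two_add: "Suc (j + s) choose 2 = (Suc j choose 2) + (s choose 2) + s * Suc j"
proof (induction s)
  case (Suc s)
  then show ?case
    using choose_two_Suc[of "Suc (j + s)"] choose_two_Suc[of s] by simp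
qed (simp add: numeral_2_eq_2)

section \<open>Gaussian binomials, the q-Chu-Vandermonde sum and the Bailey step\<close>

text \<open>The Gaussian binomial, given by a q-Pascal rule instead of a quotient, so that it makes
  sense for every q. Truncation in \<open>n - k\<close> is harmless, since
  \<open>qbinom q n k\<close> vanishes for k > n.\<close>

fun qbinom :: "complex \<Rightarrow> nat \<Rightarrow> nat \<Rightarrow> complex" where
  "qbinom q n 0 = 1"
| "qbinom q 0 (Suc k) = 0"
| "qbinom q (Suc n) (Suc k) = qbinom q n (Suc k) + q ^ (n - k) * qbinom q n k"

lemma qbinom_eq_0: "n < k \<Longrightarrow> qbinom q n k = 0"
  by (induction q n k rule: qbinom.induct) auto

text \<open>With n = k + d + 1, the q-Pascal rule reduces this to 1 - q^(n+1) = (1 - q^(d+1)) +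
  q^(d+1) (1 - q^(k+1)).\<close>

lemma qbinom_qpoch: "k \<le> n \<Longrightarrow> qbinom q n k * (qpoch q q k * qpoch q q (n - k)) = qpoch q q n"
proof (induction q n k rule: qbinom.induct)
  case (3 q n k)
  have IH: "qbinom q n k * (qpoch q q k * qpoch q q (n - k)) = qpoch q q n"
    using 3 by simp
  show ?case
  proof (cases "k = n")
    case True
    then show ?thesis
      using IH by (simp add: qbinom_eq_0 qpoch_Suc flip: mult.assoc)
  next
    case False
    then obtain d where n: "n = Suc (k + d)"
      using 3(3) by (metis Suc_le_mono add_Suc_right le_neq_implies_less less_imp_Suc_add)
    have IH': "qbinom q n (Suc k) * (qpoch q q (Suc k) * qpoch q q d) = qpoch q q n"
      using 3(1) n by simp
    have "qbinom q (Suc n) (Suc k) * (qpoch q q (Suc k) * qpoch q q (Suc n - Suc k))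
        = (qbinom q n (Suc k) * (qpoch q q (Suc k) * qpoch q q d)) * (1 - q * q ^ d)
          + q ^ Suc d * (1 - q * q ^ k) * (qbinom q n k * (qpoch q q k * qpoch q q (n - k)))"
      by (simp add: n qpoch_Suc algebra_simps)
    also have "\<dots> = qpoch q q n * (1 - q * q ^ n)"
      unfolding IH IH' by (simp add: n power_add algebra_simps)
    finally show ?thesis
      by (simp add: qpoch_Suc)
  qed
qed auto

text \<open>In the usual notation \<open>a = c / b\<close>, and both sides are multiplied by \<open>(c; q)\<^sub>n\<close>.\<close>

lemma q_Chu_Vandermonde:
  "(\<Sum>s\<le>n. qbinom q n s * qpoch b q s * (- a) ^ s * q ^ (s choose 2) * qpoch (a * b * q ^ s) q (n - s))
     = qpoch a q n"
proof (induction n arbitrary: b)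
  case (Suc n)
  define t where "t = (\<lambda>b s. qpoch b q s * (- a) ^ s * q ^ (s choose 2))"
  define f where "f = (\<lambda>b s. qbinom q n s * t b s * qpoch (a * b * q ^ s) q (n - s))"
  have IH: "(\<Sum>s\<le>n. f b s) = qpoch a q n" for b
    using Suc.IH[of b] by (simp add: f_def t_def mult.assoc)
  \<comment> \<open>Lowering s replaces b by b q, which is why the induction hypothesis is needed
    for all \<open>b\<close>.\<close>
  have ts: "t b (Suc s) = - a * (1 - b) * q ^ s * t (b * q) s" for s
    by (simp add: t_def qpoch_Suc' choose_two_Suc power_add)
  have "(\<Sum>s\<le>Suc n. qbinom q (Suc n) s * t b s * qpoch (a * b * q ^ s) q (Suc n - s))
      = qpoch (a * b) q (Suc n)
        + (\<Sum>s\<le>n. qbinom q n (Suc s) * t b (Suc s) * qpoch (a * b * q ^ Suc s) q (n - s))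
        + (\<Sum>s\<le>n. q ^ (n - s) * qbinom q n s * t b (Suc s) * qpoch (a * b * q ^ Suc s) q (n - s))"
    by (subst sum.atMost_Suc_shift)
       (simp add: t_def ring_distribs sum.distrib mult_ac binomial_eq_0 del: power_Suc)
  \<comment> \<open>The isolated symbol is the term s = 0 of the sum on the right, whose term s = n
    + 1 is zero.\<close>
  also have "qpoch (a * b) q (Suc n)
        + (\<Sum>s\<le>n. qbinom q n (Suc s) * t b (Suc s) * qpoch (a * b * q ^ Suc s) q (n - s))
      = (\<Sum>s\<le>Suc n. qbinom q n s * t b s * qpoch (a * b * q ^ s) q (Suc n - s))"
    by (subst sum.atMost_Suc_shift) (simp add: t_def binomial_eq_0)
  also have "\<dots> = (\<Sum>s\<le>n. f b s * (1 - a * b * q ^ n))"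
    by (simp add: qbinom_eq_0 f_def Suc_diff_le qpoch_Suc mult.assoc flip: power_add)
  also have "\<dots> = qpoch a q n * (1 - a * b * q ^ n)"
    by (simp add: IH flip: sum_distrib_right)
  also have "(\<Sum>s\<le>n. q ^ (n - s) * qbinom q n s * t b (Suc s) * qpoch (a * b * q ^ Suc s) q (n - s))
      = (\<Sum>s\<le>n. - a * (1 - b) * q ^ n * f (b * q) s)"
  proof (rule sum.cong)
    fix s assume "s \<in> {..n}"
    then have "q ^ n = q ^ (n - s) * q ^ s"
      by (simp flip: power_add)
    then show "q ^ (n - s) * qbinom q n s * t b (Suc s) * qpoch (a * b * q ^ Suc s) q (n - s)
      = - a * (1 - b) * q ^ n * f (b * q) s"
      by (simp add: ts f_def mult_ac)
  qed simp
  also have "\<dots> = - a * (1 - b) * q ^ n * qpoch a q n"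
    unfolding sum_distrib_left[symmetric] IH ..
  \<comment> \<open>The two parts combine by (1 - a b q^n) - a (1 - b) q^n = 1 - a q^n.\<close>
  finally show ?case
    by (simp add: t_def qpoch_Suc algebra_simps)
qed (simp add: binomial_eq_0)

text \<open>Substituting r = j + s and x = q^(j+1) turns the sum into a multiple of the
  q-Chu-Vandermonde sum with a = b = -x. Its value (-x)_N, N = m - j, completes (-q)_j to
  (-q)_m.\<close>

lemma Bailey_step:
  assumes q: "norm q < 1" and "j \<le> m"
  shows "(\<Sum>r=j..m. qpoch (- q) q r * q ^ (Suc r choose 2)
            / (qpoch q q (m - r) * qpoch q q (r - j) * qpoch q q (r + j + 1)))
       = qpoch (- q) q m * q ^ (Suc j choose 2) / (qpoch q q (m - j) * qpoch q q (m + j + 1))"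
proof -
  obtain N where m: "m = j + N"
    using \<open>j \<le> m\<close> le_Suc_ex by blast
  define x where "x = q ^ Suc j"
  note nz = qpoch_self_nonzero[OF q]
  \<comment> \<open>The summand of \<open>q_Chu_Vandermonde\<close> at a = b = -x.\<close>
  let ?T = "\<lambda>s. qbinom q N s * qpoch (- x) q s * x ^ s * q ^ (s choose 2) * qpoch (x * x * q ^ s) q (N - s)"
  have "(\<Sum>r=j..m. qpoch (- q) q r * q ^ (Suc r choose 2)
            / (qpoch q q (m - r) * qpoch q q (r - j) * qpoch q q (r + j + 1)))
      = (\<Sum>s\<le>N. qpoch (- q) q (j + s) * q ^ (Suc (j + s) choose 2)
            / (qpoch q q (N - s) * qpoch q q s * qpoch q q (2 * j + s + 1)))"
    by (rule sum.reindex_bij_witness[of _ "\<lambda>s. j + s" "\<lambda>r. r - j"]) (auto simp: m mult_2 add_ac)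
  also have "\<dots> = (\<Sum>s\<le>N. qpoch (- q) q j * q ^ (Suc j choose 2) / (qpoch q q N * qpoch q q (m + j + 1)) * ?T s)"
  proof (rule sum.cong)
    fix s assume "s \<in> {..N}"
    then have s: "s \<le> N" by simp
    have 1: "qpoch (- q) q (j + s) = qpoch (- q) q j * qpoch (- x) q s"
      by (simp add: qpoch_add x_def)
    have "m + j + 1 = (2 * j + s + 1) + (N - s)"
      using s by (simp add: m)
    then have 2: "qpoch q q (m + j + 1) = qpoch q q (2 * j + s + 1) * qpoch (x * x * q ^ s) q (N - s)"
      by (simp only: qpoch_add[of _ _ "2 * j + s + 1"]) (simp add: x_def power_add mult_2, simp add: mult_ac)
    have 3: "q ^ (Suc (j + s) choose 2) = q ^ (Suc j choose 2) * q ^ (s choose 2) * x ^ s"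
      by (simp only: choose_two_add power_add x_def power_mult mult.commute[of s])
    have 4: "qpoch q q N = qbinom q N s * (qpoch q q s * qpoch q q (N - s))"
      using qbinom_qpoch[OF s, of q] by simp
    have "qpoch (x * x * q ^ s) q (N - s) \<noteq> 0" "qbinom q N s \<noteq> 0"
      using nz[of "m + j + 1"] nz[of N] 2 4 by auto
    then show "qpoch (- q) q (j + s) * q ^ (Suc (j + s) choose 2)
            / (qpoch q q (N - s) * qpoch q q s * qpoch q q (2 * j + s + 1))
        = qpoch (- q) q j * q ^ (Suc j choose 2) / (qpoch q q N * qpoch q q (m + j + 1)) * ?T s"
      unfolding 1 2 3 4 by (simp add: nz divide_simps)
  qed simp
  also have "\<dots> = qpoch (- q) q j * q ^ (Suc j choose 2) / (qpoch q q N * qpoch q q (m + j + 1)) * qpoch (- x) q N"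
    using q_Chu_Vandermonde[of q N "- x" "- x"] unfolding sum_distrib_left[symmetric] by simp
  also have "\<dots> = qpoch (- q) q m * q ^ (Suc j choose 2) / (qpoch q q (m - j) * qpoch q q (m + j + 1))"
    by (simp add: m qpoch_add x_def)
  finally show ?thesis .
qed

section \<open>The finite Jacobi triple product\<close>

text \<open>\<open>jtp_coeff (z + 1 / z) j = (z ^ j + z powi (- j - 1)) / (1 + 1 / z)\<close>, as a polynomial in
  \<open>z + 1 / z\<close>; this form also covers \<open>z = - 1\<close>.\<close>

fun jtp_coeff :: "complex \<Rightarrow> nat \<Rightarrow> complex" where
  "jtp_coeff w 0 = 1"
| "jtp_coeff w (Suc 0) = w - 1"
| "jtp_coeff w (Suc (Suc j)) = w * jtp_coeff w (Suc j) - jtp_coeff w j"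

text \<open>Induction on n: both sides satisfy the same first-order recursion in n. On the right it
  follows from the three-term recursion of \<open>jtp_coeff\<close> and a matching contiguous
  relation for the coefficients.\<close>

lemma finite_Jacobi_triple_product:
  assumes q: "norm q < 1" and "z \<noteq> 0"
  shows "qpoch (- q / z) q n * qpoch (- z * q) q n / qpoch q q (2 * n + 1)
       = (\<Sum>j\<le>n. q ^ (Suc j choose 2) * jtp_coeff (z + 1 / z) j
             / (qpoch q q (n - j) * qpoch q q (n + j + 1)))"
proof -
  define w where "w = z + 1 / z"
  define s where "s = jtp_coeff w"
  \<comment> \<open>The left neighbour of \<open>s j\<close>. At j = 0 truncation gives
    \<open>s 0\<close>, in accordance with the symmetry j -> -1 - j, so \<open>ws\<close> holds
    there too.\<close>
  define s' where "s' j = s (j - 1)" for j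
  define u where "u n j = (if j \<le> n then q ^ (Suc j choose 2) / (qpoch q q (n - j) * qpoch q q (n + j + 1)) else 0)"
    for n j
  note nz = qpoch_self_nonzero[OF q]
  have nz1: "1 - q * q ^ m \<noteq> 0" for m
    using power_neq_1_of_norm_less_1[OF q, of "Suc m"] by simp
  have ws: "w * s j = s (Suc j) + s' j" for j
    by (cases j) (simp_all add: s_def s'_def)
  have u_eq: "u (j + d) j = q ^ (Suc j choose 2) / (qpoch q q d * qpoch q q (2 * j + d + 1))" for j d
    by (simp add: u_def mult_2 add_ac)
  \<comment> \<open>The factor 1 - q^d makes the formula valid at d = 0, where the left side is 0 by
    definition of \<open>u\<close>.\<close>
  have u_Suc: "u (j + d) (Suc j)
      = q ^ (Suc j choose 2) * q ^ Suc j * (1 - q ^ d) / (qpoch q q d * qpoch q q (2 * j + d + 2))" for j d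
  proof (cases d)
    case 0
    then show ?thesis by (simp add: u_def)
  next
    case (Suc e)
    have "u (j + d) (Suc j) = u (Suc j + e) (Suc j)"
      by (simp add: Suc)
    also have "\<dots> = q ^ (Suc (Suc j) choose 2) / (qpoch q q e * qpoch q q (2 * j + d + 2))"
      by (simp only: u_eq) (simp add: Suc)
    finally show ?thesis
      by (simp add: choose_two_Suc[of "Suc j"] power_add Suc qpoch_Suc[of _ _ e])
         (use nz1[of e] in simp)
  qed
  \<comment> \<open>Cancels t / e, so that only a polynomial identity between numerators over a
    common denominator remains.\<close>
  have common_factor: "c * (t * x / e) = c' * (t * y / e) + d * (t * v / e + t * v' / e)"
    if "c * x = c' * y + d * (v + v')" for c c' d x y v v' t e :: complex
  proof -
    have "c * (t * x / e) = t * (c * x) / e"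
      by simp
    then show ?thesis
      unfolding that by (simp add: ring_distribs add_divide_distrib mult_ac)
  qed
  \<comment> \<open>The right side is the coefficient of \<open>s j\<close> in (1 + q^(2n+2) +
    q^(n+1) w) P n. At j = 0 the truncated \<open>j - 1\<close> supplies the reflected neighbour
    \<open>u n 0\<close>.\<close>
  have rec: "(1 - q ^ (2 * n + 2)) * (1 - q ^ (2 * n + 3)) * u (Suc n) j
      = (1 + q ^ (2 * n + 2)) * u n j + q ^ Suc n * (u n (j - 1) + u n (Suc j))" for n j
  proof -
    \<comment> \<open>Reflected boundary, interior, the new top index (where only
      \<open>u n n\<close> survives on the right), and the range where everything vanishes.\<close>
    consider "j = 0" | i where "j = Suc i" "j \<le> n" | "j = Suc n" | "j > Suc n"
      by (metis Suc_lessI gr0_implies_Suc neq0_conv not_le)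
    then show ?thesis
    proof cases
      case 1
      have u: "u (Suc n) 0 = 1 / (qpoch q q (Suc n) * qpoch q q (Suc (Suc n)))"
        "u n 0 = 1 / (qpoch q q n * qpoch q q (Suc n))"
        "u n (Suc 0) = q * (1 - q ^ n) / (qpoch q q n * qpoch q q (Suc (Suc n)))"
        using u_eq[of 0 "Suc n"] u_eq[of 0 n] u_Suc[of 0 n] by (simp_all add: numeral_2_eq_2)
      have pw: "q ^ (2 * n + 2) = (q ^ n)\<^sup>2 * q\<^sup>2" "q ^ (2 * n + 3) = (q ^ n)\<^sup>2 * q ^ 3"
        by (simp_all add: power_add power_even_eq power2_eq_square[of q])
      define E where "E = qpoch q q n * qpoch q q n * (1 - q * q ^ n) * (1 - q * q ^ n) * (1 - q * (q * q ^ n))"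
      have U:
        "u (Suc n) 0 = 1 * 1 / E"
        "u n 0 = 1 * ((1 - q * q ^ n) * (1 - q * (q * q ^ n))) / E"
        "u n (Suc 0) = 1 * (q * (1 - q ^ n) * (1 - q * q ^ n)) / E"
        using nz1[of n] nz1[of "Suc n"]
        unfolding u E_def qpoch_Suc by simp_all
      have "(1 - q ^ (2 * n + 2)) * (1 - q ^ (2 * n + 3)) * 1
          = (1 + q ^ (2 * n + 2)) * ((1 - q * q ^ n) * (1 - q * (q * q ^ n)))
            + q ^ Suc n * ((1 - q * q ^ n) * (1 - q * (q * q ^ n)) + q * (1 - q ^ n) * (1 - q * q ^ n))"
        unfolding pw power_Suc by algebra
      from common_factor[OF this] show ?thesis
        unfolding 1 diff_0_eq_0 U .
    next
      case 2
      then obtain d where n: "n = Suc i + d"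
        using le_Suc_ex by blast
      define m where "m = 2 * i + d + 2"
      have u: "u n i = q ^ (Suc i choose 2) / (qpoch q q (Suc d) * qpoch q q m)"
        "u n j = q ^ (Suc i choose 2) * q ^ Suc i / (qpoch q q d * qpoch q q (Suc m))"
        "u n (Suc j) = q ^ (Suc i choose 2) * q ^ Suc i * q ^ Suc j * (1 - q ^ d)
            / (qpoch q q d * qpoch q q (Suc (Suc m)))"
        "u (Suc n) j = q ^ (Suc i choose 2) * q ^ Suc i
            / (qpoch q q (Suc d) * qpoch q q (Suc (Suc m)))"
        using u_eq[of i "Suc d"] u_eq[of j d] u_eq[of j "Suc d"] u_Suc[of j d] 2
          choose_two_Suc[of "Suc i"]
        by (simp_all add: n m_def power_add)
      have pw: "q ^ (2 * n + 2) = (q ^ i)\<^sup>2 * (q ^ d)\<^sup>2 * q ^ 4"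
        "q ^ (2 * n + 3) = (q ^ i)\<^sup>2 * (q ^ d)\<^sup>2 * q ^ 5"
        "q ^ Suc n = q ^ i * q ^ d * q\<^sup>2" "q ^ m = (q ^ i)\<^sup>2 * q ^ d * q\<^sup>2"
        by (simp_all add: n m_def mult_2 power_add power2_eq_square eval_nat_numeral)
      define E where "E = qpoch q q d * (1 - q * q ^ d) * qpoch q q m
          * (1 - q * q ^ m) * (1 - q * (q * q ^ m))"
      have U:
        "u (Suc n) j = q ^ (Suc i choose 2) * (q * q ^ i) / E"
        "u n i = q ^ (Suc i choose 2) * ((1 - q * q ^ m) * (1 - q * (q * q ^ m))) / E"
        "u n j = q ^ (Suc i choose 2) * ((q * q ^ i) * (1 - q * q ^ d) * (1 - q * (q * q ^ m))) / E"
        "u n (Suc j) = q ^ (Suc i choose 2) * ((q * q ^ i) * (q * (q * q ^ i)) * (1 - q ^ d) * (1 - q * q ^ d)) / E"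
        using nz1[of d] nz1[of m] nz1[of "Suc m"]
        unfolding u E_def qpoch_Suc by (simp_all add: 2(1) mult.assoc)
      have "(1 - q ^ (2 * n + 2)) * (1 - q ^ (2 * n + 3)) * (q * q ^ i)
          = (1 + q ^ (2 * n + 2)) * ((q * q ^ i) * (1 - q * q ^ d) * (1 - q * (q * q ^ m)))
            + q ^ Suc n * ((1 - q * q ^ m) * (1 - q * (q * q ^ m))
              + (q * q ^ i) * (q * (q * q ^ i)) * (1 - q ^ d) * (1 - q * q ^ d))"
        unfolding pw by algebra
      moreover have "j - 1 = i"
        by (simp add: 2)
      ultimately show ?thesis
        by (simp only: U common_factor)
    next
      case 3
      have 1: "u (Suc n) (Suc n) = q ^ (Suc n choose 2) * q ^ Suc n / qpoch q q (Suc (Suc (2 * n + 1)))"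
        using u_eq[of "Suc n" 0] choose_two_Suc[of "Suc n"] by (simp add: power_add)
      have 2: "u n n = q ^ (Suc n choose 2) / qpoch q q (2 * n + 1)"
        using u_eq[of n 0] by simp
      have "1 - q ^ (2 * n + 2) \<noteq> 0" "1 - q ^ (2 * n + 3) \<noteq> 0"
        using power_neq_1_of_norm_less_1[OF q, of "2 * n + 2"] power_neq_1_of_norm_less_1[OF q, of "2 * n + 3"] by auto
      moreover have "qpoch q q (Suc (Suc (2 * n + 1)))
          = qpoch q q (2 * n + 1) * (1 - q ^ (2 * n + 2)) * (1 - q ^ (2 * n + 3))"
        by (simp add: qpoch_Suc numeral_3_eq_3)
      ultimately have "(1 - q ^ (2 * n + 2)) * (1 - q ^ (2 * n + 3)) * u (Suc n) (Suc n) = q ^ Suc n * u n n"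
        unfolding 1 2 by simp
      then show ?thesis
        using 3 by (simp add: u_def)
    qed (auto simp: u_def)
  qed
  define P where "P n = (\<Sum>j\<le>n. s j * u n j)" for n
  have P_rec: "(1 - q ^ (2 * n + 2)) * (1 - q ^ (2 * n + 3)) * P (Suc n)
      = (1 + q ^ (2 * n + 2) + q ^ Suc n * w) * P n" for n
  proof -
    \<comment> \<open>Summation by parts: \<open>ws\<close> trades the factor w for a shift of the
      index of \<open>u\<close>.\<close>
    have "(\<Sum>j\<le>Suc n. s j * u n (j - 1)) = s 0 * u n 0 + (\<Sum>j\<le>n. s (Suc j) * u n j)"
      by (subst sum.atMost_Suc_shift) simp
    moreover have "(\<Sum>j\<le>Suc (Suc n). s' j * u n j) = s 0 * u n 0 + (\<Sum>j\<le>Suc n. s j * u n (Suc j))"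
      by (subst sum.atMost_Suc_shift) (simp add: s'_def)
    moreover have "(\<Sum>j\<le>Suc (Suc n). s' j * u n j) = (\<Sum>j\<le>n. s' j * u n j)"
      by (simp add: u_def)
    ultimately have wP: "(\<Sum>j\<le>Suc n. s j * (u n (j - 1) + u n (Suc j))) = w * P n"
      by (simp add: P_def sum_distrib_left ring_distribs sum.distrib ws flip: mult.assoc)
    have "(1 - q ^ (2 * n + 2)) * (1 - q ^ (2 * n + 3)) * P (Suc n)
        = (\<Sum>j\<le>Suc n. s j * ((1 - q ^ (2 * n + 2)) * (1 - q ^ (2 * n + 3)) * u (Suc n) j))"
      unfolding P_def sum_distrib_left by (simp only: mult_ac)
    also have "\<dots> = (1 + q ^ (2 * n + 2)) * (\<Sum>j\<le>Suc n. s j * u n j)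
        + q ^ Suc n * (\<Sum>j\<le>Suc n. s j * (u n (j - 1) + u n (Suc j)))"
      unfolding rec sum_distrib_left sum.distrib[symmetric]
      by (rule sum.cong) (simp_all only: ring_distribs mult_ac)
    also have "(\<Sum>j\<le>Suc n. s j * u n j) = P n"
      by (simp add: P_def u_def)
    finally show ?thesis
      unfolding wP by (simp add: algebra_simps)
  qed
  have "qpoch (- q / z) q n * qpoch (- z * q) q n / qpoch q q (2 * n + 1) = P n"
  proof (induction n)
    case 0
    then show ?case by (simp add: P_def u_def s_def numeral_2_eq_2 qpoch_Suc)
  next
    case (Suc n)
    have e: "2 * Suc n + 1 = Suc (Suc (2 * n + 1))"
      by simp
    have p: "q ^ (2 * n + 2) = q * q ^ (2 * n + 1)" "q ^ (2 * n + 3) = q * q ^ Suc (2 * n + 1)"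
      by (simp_all add: numeral_3_eq_3)
    have pn: "1 - q ^ (2 * n + 2) \<noteq> 0" "1 - q ^ (2 * n + 3) \<noteq> 0"
      using power_neq_1_of_norm_less_1[OF q, of "2 * n + 2"] power_neq_1_of_norm_less_1[OF q, of "2 * n + 3"] by auto
    \<comment> \<open>The two new factors depend on z only through w, and give the multiplier in
      \<open>P_rec\<close>.\<close>
    have "(1 - - q / z * q ^ n) * (1 - - z * q * q ^ n) = 1 + q ^ (2 * n + 2) + q ^ Suc n * w"
    proof -
      have "q ^ (2 * n + 2) = q * q ^ n * (q * q ^ n)"
        by (simp add: power_add power_even_eq power2_eq_square)
      then show ?thesis
        using \<open>z \<noteq> 0\<close> by (simp only:) (simp add: w_def field_simps)
    qed
    then have "qpoch (- q / z) q (Suc n) * qpoch (- z * q) q (Suc n)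
      = (qpoch (- q / z) q n * qpoch (- z * q) q n) * (1 + q ^ (2 * n + 2) + q ^ Suc n * w)"
      by (simp only: qpoch_Suc mult_ac)
    also have "\<dots> / qpoch q q (2 * Suc n + 1)
        = (1 + q ^ (2 * n + 2) + q ^ Suc n * w) * P n / ((1 - q ^ (2 * n + 2)) * (1 - q ^ (2 * n + 3)))"
      unfolding e qpoch_Suc p[symmetric] Suc.IH[symmetric] by (simp add: mult_ac)
    also have "\<dots> = P (Suc n)"
      unfolding P_rec[symmetric] using pn by simp
    finally show ?case .
  qed
  then show ?thesis
    by (simp add: P_def u_def s_def w_def mult.commute)
qed

section \<open>The Bailey chain\<close>

text \<open>The step of the Bailey chain for \<open>a = q\<close>, \<open>\<rho>\<^sub>1 = - q\<close>, \<open>\<rho>\<^sub>2 \<rightarrow> \<infinity>\<close>, acting on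
  \<open>c\<^sub>m = (- q)\<^sub>m \<beta>\<^sub>m\<close>: with this normalisation the factors \<open>(- q)\<^sub>m\<close> cancel along the chain.\<close>

definition Bailey_op :: "complex \<Rightarrow> (nat \<Rightarrow> complex) \<Rightarrow> nat \<Rightarrow> complex" where
  "Bailey_op q c m = (\<Sum>r\<le>m. q ^ (Suc r choose 2) * c r / qpoch q q (m - r))"

text \<open>After exchanging the sums, the inner one is \<open>Bailey_step\<close>, which consumes
  (-q)_r and returns the (-q)_m required by the next application.\<close>

lemma Bailey_op_funpow:
  assumes q: "norm q < 1"
    and c: "\<And>m. c m = qpoch (- q) q m * (\<Sum>j\<le>m. \<alpha> j / (qpoch q q (m - j) * qpoch q q (m + j + 1)))"
  shows "(Bailey_op q ^^ k) c m = qpoch (- q) q m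
           * (\<Sum>j\<le>m. q ^ (k * (Suc j choose 2)) * \<alpha> j / (qpoch q q (m - j) * qpoch q q (m + j + 1)))"
proof (induction k arbitrary: m)
  case 0
  then show ?case by (simp add: c)
next
  case (Suc k)
  define \<gamma> where "\<gamma> j = q ^ (k * (Suc j choose 2)) * \<alpha> j" for j
  define f where "f r j = \<gamma> j * (qpoch (- q) q r * q ^ (Suc r choose 2)
      / (qpoch q q (m - r) * qpoch q q (r - j) * qpoch q q (r + j + 1)))" for r j
  have "(Bailey_op q ^^ Suc k) c m = (\<Sum>r\<le>m. \<Sum>j\<le>r. f r j)"
    by (simp add: Bailey_op_def Suc.IH f_def \<gamma>_def sum_distrib_left sum_divide_distrib mult_ac)
  also have "\<dots> = (\<Sum>j\<le>m. \<Sum>r=j..m. f r j)"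
    by (simp add: sum.Sigma)
       (rule sum.reindex_bij_witness[of _ prod.swap prod.swap]; auto)
  also have "\<dots> = (\<Sum>j\<le>m. \<gamma> j * (qpoch (- q) q m * q ^ (Suc j choose 2)
      / (qpoch q q (m - j) * qpoch q q (m + j + 1))))"
    by (intro sum.cong) (simp_all only: f_def Bailey_step[OF q] atMost_iff flip: sum_distrib_left)
  finally show ?case
    by (simp add: \<gamma>_def sum_distrib_left power_add mult_ac)
qed

section \<open>Truncated sums over decreasing tuples\<close>

lemma decr_tuples_1: "{n \<in> decr_tuples (Suc 0). n 1 \<le> N} = (\<lambda>r. (\<lambda>_. undefined)(1 := r)) ` {..N}"
proof (intro equalityI subsetI)
  fix n assume "n \<in> {n \<in> decr_tuples (Suc 0). n 1 \<le> N}"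
  then have "n = (\<lambda>_. undefined)(1 := n 1)" "n 1 \<le> N"
    by (auto simp: decr_tuples_def PiE_def extensional_def)
  then show "n \<in> (\<lambda>r. (\<lambda>_. undefined)(1 := r)) ` {..N}"
    by blast
qed (auto simp: decr_tuples_def PiE_def extensional_def)

lemma decr_tuples_Suc:
  "{n \<in> decr_tuples (Suc (Suc k)). n 1 \<le> N}
    = (\<lambda>(n, r). n(Suc (Suc k) := r)) ` (SIGMA n:{n \<in> decr_tuples (Suc k). n 1 \<le> N}. {..n (Suc k)})"
proof (intro equalityI subsetI)
  fix n assume n: "n \<in> {n \<in> decr_tuples (Suc (Suc k)). n 1 \<le> N}"
  \<comment> \<open>Resetting the last slot keeps the shortened tuple extensional.\<close>
  define n' where "n' = n(Suc (Suc k) := undefined)"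
  have "n = n'(Suc (Suc k) := n (Suc (Suc k)))"
    by (simp add: n'_def)
  moreover have "(n', n (Suc (Suc k))) \<in> (SIGMA n:{n \<in> decr_tuples (Suc k). n 1 \<le> N}. {..n (Suc k)})"
    using n by (auto simp: n'_def decr_tuples_def PiE_def extensional_def)
  ultimately show "n \<in> (\<lambda>(n, r). n(Suc (Suc k) := r)) ` (SIGMA n:{n \<in> decr_tuples (Suc k). n 1 \<le> N}. {..n (Suc k)})"
    by (metis (mono_tags, lifting) case_prod_conv image_eqI)
next
  fix n assume "n \<in> (\<lambda>(n, r). n(Suc (Suc k) := r)) ` (SIGMA n:{n \<in> decr_tuples (Suc k). n 1 \<le> N}. {..n (Suc k)})"
  then obtain n' r where "n = n'(Suc (Suc k) := r)" "n' \<in> decr_tuples (Suc k)" "n' 1 \<le> N" "r \<le> n' (Suc k)"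
    by auto
  then show "n \<in> {n \<in> decr_tuples (Suc (Suc k)). n 1 \<le> N}"
    by (auto simp: decr_tuples_def PiE_def extensional_def le_Suc_eq less_Suc_eq)
qed

lemma inj_on_decr_tuples_upd:
  "inj_on (\<lambda>(n, r). n(Suc k := r)) (SIGMA n:{n \<in> decr_tuples k. P n}. B n)"
proof (rule inj_onI, safe)
  fix n n' :: "nat \<Rightarrow> nat" and r r'
  assume n: "n \<in> decr_tuples k" "n' \<in> decr_tuples k" and eq: "n(Suc k := r) = n'(Suc k := r')"
  \<comment> \<open>At \<open>Suc k\<close> both tuples are \<open>undefined\<close>; elsewhere the
    update changes nothing.\<close>
  have "n i = n' i" for i
    using n fun_cong[OF eq, of i] by (cases "i = Suc k") (auto simp: decr_tuples_def PiE_def extensional_def)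
  then show "n = n'" ..
  show "r = r'"
    using fun_cong[OF eq, of "Suc k"] by simp
qed

lemma finite_decr_tuples: "finite {n \<in> decr_tuples (Suc k). n 1 \<le> N}"
proof (induction k)
  case (Suc k)
  then show ?case
    unfolding decr_tuples_Suc by (intro finite_imageI finite_SigmaI) auto
qed (simp only: decr_tuples_1 finite_imageI finite_atMost)

text \<open>Peeling off the last index \<open>n\<^sub>k\<close> turns a sum over tuples with final weight \<open>c\<close> into one over shorter
  tuples with final weight \<open>Bailey_op q c\<close>.\<close>

lemma sum_decr_tuples:
  "(\<Sum>n | n \<in> decr_tuples (Suc k) \<and> n 1 \<le> N. c (n (Suc k)) * q ^ (\<Sum>i=1..Suc k. Suc (n i) choose 2)
       / (\<Prod>i=1..<Suc k. qpoch q q (n i - n (Suc i))))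
   = (\<Sum>r\<le>N. q ^ (Suc r choose 2) * (Bailey_op q ^^ k) c r)"
proof (induction k arbitrary: c)
  case 0
  have "inj_on (\<lambda>r. (\<lambda>_. undefined)(Suc 0 := r)) {..N}"
    by (rule inj_onI) (metis fun_upd_same)
  then show ?case
    by (simp add: decr_tuples_1[simplified] sum.reindex mult.commute)
next
  case (Suc k)
  let ?A = "{n \<in> decr_tuples (Suc k). n 1 \<le> N}"
  define e where "e n = (\<Sum>i=1..Suc k. Suc (n i) choose 2)" for n
  define d where "d n = (\<Prod>i=1..<Suc k. qpoch q q (n i - n (Suc i)))" for n
  have e: "(\<Sum>i=1..Suc (Suc k). Suc ((n(Suc (Suc k) := r)) i) choose 2) = e n + (Suc r choose 2)" for n r
  proof -
    have "(\<Sum>i=1..Suc k. Suc ((n(Suc (Suc k) := r)) i) choose 2) = e n"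
      unfolding e_def by (intro sum.cong) auto
    then show ?thesis by simp
  qed
  have d: "(\<Prod>i=1..<Suc (Suc k). qpoch q q ((n(Suc (Suc k) := r)) i - (n(Suc (Suc k) := r)) (Suc i)))
      = d n * qpoch q q (n (Suc k) - r)" for n r
  proof -
    have "(\<Prod>i=1..<Suc k. qpoch q q ((n(Suc (Suc k) := r)) i - (n(Suc (Suc k) := r)) (Suc i))) = d n"
      unfolding d_def by (intro prod.cong) auto
    then show ?thesis by simp
  qed
  have "(\<Sum>n | n \<in> decr_tuples (Suc (Suc k)) \<and> n 1 \<le> N.
          c (n (Suc (Suc k))) * q ^ (\<Sum>i=1..Suc (Suc k). Suc (n i) choose 2)
          / (\<Prod>i=1..<Suc (Suc k). qpoch q q (n i - n (Suc i))))
      = (\<Sum>(n, r)\<in>(SIGMA n:?A. {..n (Suc k)}).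
          c r * q ^ (e n + (Suc r choose 2)) / (d n * qpoch q q (n (Suc k) - r)))"
    unfolding decr_tuples_Suc
    by (subst sum.reindex[OF inj_on_decr_tuples_upd])
       (simp only: o_def case_prod_unfold e d fun_upd_same)
  also have "\<dots> = (\<Sum>n\<in>?A. \<Sum>r\<le>n (Suc k). c r * q ^ (e n + (Suc r choose 2)) / (d n * qpoch q q (n (Suc k) - r)))"
    by (subst sum.Sigma) (use finite_decr_tuples in auto)
  also have "\<dots> = (\<Sum>n\<in>?A. Bailey_op q c (n (Suc k)) * q ^ e n / d n)"
    by (simp add: Bailey_op_def sum_distrib_right sum_distrib_left sum_divide_distrib power_add mult_ac)
  also have "\<dots> = (\<Sum>r\<le>N. q ^ (Suc r choose 2) * (Bailey_op q ^^ k) (Bailey_op q c) r)"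
    using Suc.IH[of "Bailey_op q c"] by (simp only: e_def d_def)
  finally show ?case
    by (simp only: funpow_Suc_right o_def)
qed

section \<open>Absolute convergence of the multiple sum\<close>

text \<open>Allows an unordered sum over all tuples to be computed along the truncations: finitely
  many tuples have a largest first entry.\<close>

lemma filterlim_decr_tuples:
  "filterlim (\<lambda>N. {n \<in> decr_tuples (Suc k). n 1 \<le> N}) (finite_subsets_at_top (decr_tuples (Suc k))) sequentially"
  unfolding filterlim_finite_subsets_at_top
proof (intro allI impI)
  fix X assume X: "finite X \<and> X \<subseteq> decr_tuples (Suc k)"
  have "X \<subseteq> {n \<in> decr_tuples (Suc k). n 1 \<le> N}" if "N \<ge> Max ((\<lambda>n. n 1) ` X)" for N
  proof
    fix n assume "n \<in> X"
    then have "n 1 \<le> N"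
      using X by (intro order_trans[OF Max_ge that]) auto
    with \<open>n \<in> X\<close> show "n \<in> {n \<in> decr_tuples (Suc k). n 1 \<le> N}"
      using X by auto
  qed
  then show "\<forall>\<^sub>F N in sequentially. finite {n \<in> decr_tuples (Suc k). n 1 \<le> N}
      \<and> X \<subseteq> {n \<in> decr_tuples (Suc k). n 1 \<le> N} \<and> {n \<in> decr_tuples (Suc k). n 1 \<le> N} \<subseteq> decr_tuples (Suc k)"
    using finite_decr_tuples by (intro eventually_sequentiallyI) auto
qed

text \<open>Any finite set of index functions lies in a box, over which the sum factors into partial
  geometric sums, each at most 1 / (1 - x).\<close>

lemma summable_on_PiE_power_prod:
  fixes x :: real
  assumes x: "0 \<le> x" "x < 1" and I: "finite I"
  shows "(\<lambda>n. \<Prod>i\<in>I. x ^ n i) summable_on (I \<rightarrow>\<^sub>E UNIV)"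
proof (rule nonneg_bdd_above_summable_on)
  show "bdd_above (sum (\<lambda>n. \<Prod>i\<in>I. x ^ n i) ` {F. F \<subseteq> I \<rightarrow>\<^sub>E UNIV \<and> finite F})"
  proof (rule bdd_aboveI2)
    fix F assume F: "F \<in> {F. F \<subseteq> I \<rightarrow>\<^sub>E (UNIV :: nat set) \<and> finite F}"
    define N where "N = Max (\<Union>n\<in>F. n ` I)"
    have le: "n i \<le> N" if "n \<in> F" "i \<in> I" for n i
      unfolding N_def using that F I by (intro Max_ge) auto
    have "F \<subseteq> I \<rightarrow>\<^sub>E {..N}"
      using F le by (auto simp: PiE_iff)
    then have "(\<Sum>n\<in>F. \<Prod>i\<in>I. x ^ n i) \<le> (\<Sum>n\<in>I \<rightarrow>\<^sub>E {..N}. \<Prod>i\<in>I. x ^ n i)"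
      using I x by (intro sum_mono2 finite_PiE prod_nonneg) auto
    also have "\<dots> = (\<Prod>i\<in>I. \<Sum>y\<le>N. x ^ y)"
      using I by (subst prod_sum_PiE) auto
    also have "\<dots> \<le> (\<Prod>i\<in>I. 1 / (1 - x))"
      using x sum_le_suminf[of "(^) x" "{..N}"] suminf_geometric[of x]
      by (intro prod_mono conjI sum_nonneg) (auto simp: summable_geometric)
    finally show "(\<Sum>n\<in>F. \<Prod>i\<in>I. x ^ n i) \<le> (\<Prod>i\<in>I. 1 / (1 - x))" .
  qed
qed (use x in \<open>auto intro: prod_nonneg\<close>)

text \<open>Comparison with a product of geometric series: m is at most (m+1 choose 2), and each of
  the k - 1 reciprocals contributes at most \<open>M\<close>.\<close>

lemma summable_on_decr_tuples:
  fixes c :: "nat \<Rightarrow> complex"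
  assumes q: "norm q < 1" and C: "\<And>m. norm (c m) \<le> C" and M: "\<And>m. norm (1 / qpoch q q m) \<le> M"
  shows "(\<lambda>n. c (n k) * q ^ (\<Sum>i=1..k. Suc (n i) choose 2)
       / (\<Prod>i=1..<k. qpoch q q (n i - n (Suc i)))) summable_on decr_tuples k"
proof (rule abs_summable_summable, rule Infinite_Sum.abs_summable_on_comparison_test')
  have "(\<lambda>n. \<Prod>i=1..k. norm q ^ n i) summable_on decr_tuples k"
    by (rule summable_on_subset_banach[OF summable_on_PiE_power_prod])
       (use q in \<open>auto simp: decr_tuples_def\<close>)
  then show "(\<lambda>n. C * M ^ (k - 1) * (\<Prod>i=1..k. norm q ^ n i)) summable_on decr_tuples k"
    by (rule summable_on_cmult_right)
next
  fix n
  have [simp]: "C \<ge> 0" "M \<ge> 0"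
    using order_trans[OF norm_ge_zero C] order_trans[OF norm_ge_zero M] by auto
  have "m \<le> Suc m choose 2" for m
    by (simp add: numeral_2_eq_2)
  then have "norm q ^ (\<Sum>i=1..k. Suc (n i) choose 2) \<le> norm q ^ (\<Sum>i=1..k. n i)"
    using q by (intro power_decreasing sum_mono) auto
  then have 1: "norm q ^ (\<Sum>i=1..k. Suc (n i) choose 2) \<le> (\<Prod>i=1..k. norm q ^ n i)"
    by (simp add: power_sum)
  have 2: "(\<Prod>i=1..<k. norm (1 / qpoch q q (n i - n (Suc i)))) \<le> M ^ (k - 1)"
    using prod_mono[of "{1..<k}" "\<lambda>i. norm (1 / qpoch q q (n i - n (Suc i)))" "\<lambda>_. M"] M by simp
  have "norm (c (n k) * q ^ (\<Sum>i=1..k. Suc (n i) choose 2) / (\<Prod>i=1..<k. qpoch q q (n i - n (Suc i))))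
      = norm (c (n k)) * norm q ^ (\<Sum>i=1..k. Suc (n i) choose 2)
        * (\<Prod>i=1..<k. norm (1 / qpoch q q (n i - n (Suc i))))"
    by (simp add: norm_mult norm_divide norm_power prod_dividef flip: prod_norm)
  also have "\<dots> \<le> C * (\<Prod>i=1..k. norm q ^ n i) * M ^ (k - 1)"
    using C 1 2 by (intro mult_mono prod_nonneg) (auto intro!: mult_nonneg_nonneg prod_nonneg)
  finally show "norm (c (n k) * q ^ (\<Sum>i=1..k. Suc (n i) choose 2) / (\<Prod>i=1..<k. qpoch q q (n i - n (Suc i))))
      \<le> C * M ^ (k - 1) * (\<Prod>i=1..k. norm q ^ n i)"
    by (simp add: mult_ac)
qed

section \<open>Limits of Bailey pairs and the Jacobi triple product\<close>

text \<open>Setting the terms with j > N to 0 turns the growing sums into series dominated by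
  \<open>norm (a j) * M\<close>.\<close>

lemma tendsto_sum_Tannery:
  fixes a :: "nat \<Rightarrow> complex"
  assumes a: "summable (\<lambda>j. norm (a j))" and M: "\<And>N j. norm (b N j) \<le> M"
    and lim: "\<And>j. (\<lambda>N. b N j) \<longlonglongrightarrow> L"
  shows "(\<lambda>N. \<Sum>j\<le>N. a j * b N j) \<longlonglongrightarrow> (\<Sum>j. a j) * L"
proof -
  define f where "f j N = (if j \<le> N then a j * b N j else 0)" for j N
  have M0: "M \<ge> 0"
    using order_trans[OF norm_ge_zero M] .
  have "(\<lambda>N. \<Sum>j. f j N) \<longlonglongrightarrow> (\<Sum>j. a j * L)"
  proof (rule tannerys_theorem[THEN conjunct2, THEN conjunct2])
    show "(\<lambda>N. f j N) \<longlonglongrightarrow> a j * L" for j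
    proof (rule Lim_transform_eventually)
      show "(\<lambda>N. a j * b N j) \<longlonglongrightarrow> a j * L"
        by (rule tendsto_mult_left[OF lim])
      show "\<forall>\<^sub>F N in sequentially. a j * b N j = f j N"
        using eventually_ge_at_top[of j] by eventually_elim (simp add: f_def)
    qed
    show "\<forall>\<^sub>F (j, N) in sequentially \<times>\<^sub>F sequentially. norm (f j N) \<le> norm (a j) * M"
      using M M0 by (intro always_eventually) (auto simp: f_def norm_mult intro!: mult_left_mono)
    show "summable (\<lambda>j. norm (a j) * M)"
      using a by (rule summable_mult2)
  qed simp
  moreover have "(\<Sum>j. f j N) = (\<Sum>j\<le>N. a j * b N j)" for N
    by (subst suminf_finite[of "{..N}"]) (auto simp: f_def)
  moreover have "(\<Sum>j. a j * L) = (\<Sum>j. a j) * L"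
    by (rule suminf_mult2[OF summable_norm_cancel[OF a], symmetric])
  ultimately show ?thesis
    by simp
qed

lemma convergent_prod_qpoch:
  assumes "norm q < 1"
  shows "convergent_prod (\<lambda>j. 1 - a * q ^ j :: complex)"
  by (intro abs_convergent_prod_imp_convergent_prod summable_imp_abs_convergent_prod)
     (use assms in \<open>simp add: norm_mult norm_power summable_mult summable_geometric\<close>)

lemma qpoch_tendsto:
  assumes "norm q < 1"
  shows "qpoch a q \<longlonglongrightarrow> qpoch_inf a q"
proof (rule filterlim_sequentially_Suc[THEN iffD1])
  show "(\<lambda>n. qpoch a q (Suc n)) \<longlonglongrightarrow> qpoch_inf a q"
    using convergent_prod_LIMSEQ[OF convergent_prod_qpoch[OF assms, of a]]
    by (simp only: qpoch_inf_def qpoch_conv_prod lessThan_Suc_atMost)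
qed

lemma qpoch_inf_self_nonzero:
  assumes "norm q < 1"
  shows "qpoch_inf q q \<noteq> 0"
  unfolding qpoch_inf_def
proof (intro prodinf_nonzero convergent_prod_qpoch assms)
  show "1 - q * q ^ j \<noteq> 0" for j
    using power_neq_1_of_norm_less_1[OF assms, of "Suc j"] by simp
qed

lemma inverse_qpoch_bounded:
  assumes "norm q < 1"
  obtains M where "\<And>m. norm (1 / qpoch q q m) \<le> M"
proof -
  have "(\<lambda>m. 1 / qpoch q q m) \<longlonglongrightarrow> 1 / qpoch_inf q q"
    by (intro tendsto_intros qpoch_tendsto qpoch_inf_self_nonzero assms)
  then have "Bseq (\<lambda>m. 1 / qpoch q q m)"
    by (intro convergent_imp_Bseq convergentI)
  then show ?thesis
    using that by (auto simp: Bseq_def)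
qed

text \<open>A crude geometric bound is enough, because the exponent of p in the theta series is
  quadratic in j.\<close>

lemma jtp_coeff_bound: "norm (jtp_coeff w j) \<le> (1 + norm w) ^ j"
proof (induction w j rule: jtp_coeff.induct)
  case (2 w)
  then show ?case
    using norm_triangle_ineq4[of w 1] by simp
next
  case (3 w j)
  have "norm (jtp_coeff w (Suc (Suc j))) \<le> norm w * norm (jtp_coeff w (Suc j)) + norm (jtp_coeff w j)"
    using norm_triangle_ineq4[of "w * jtp_coeff w (Suc j)" "jtp_coeff w j"] by (simp add: norm_mult)
  also have "\<dots> \<le> norm w * (1 + norm w) ^ Suc j + (1 + norm w) ^ j"
    using 3 by (intro add_mono mult_left_mono) auto
  also have "\<dots> \<le> norm w * (1 + norm w) ^ Suc j + (1 + norm w) ^ Suc j"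
    by (intro add_left_mono power_increasing) auto
  finally show ?case
    by (simp add: algebra_simps)
qed simp

lemma summable_theta:
  assumes "norm p < 1"
  shows "summable (\<lambda>j. norm (p ^ (Suc j choose 2) * jtp_coeff w j))"
proof (rule summable_comparison_test')
  define f where "f j = norm p ^ (Suc j choose 2) * (1 + norm w) ^ j" for j
  \<comment> \<open>The ratio of consecutive values of \<open>f\<close>.\<close>
  have "(\<lambda>j. norm p ^ Suc j * (1 + norm w)) \<longlonglongrightarrow> 0 * (1 + norm w)"
    using assms by (intro tendsto_mult_right LIMSEQ_Suc LIMSEQ_power_zero) auto
  then have "\<forall>\<^sub>F j in sequentially. norm p ^ Suc j * (1 + norm w) < 1 / 2"
    by (intro order_tendstoD(2)) auto
  then obtain N where N: "\<And>j. j \<ge> N \<Longrightarrow> norm p ^ Suc j * (1 + norm w) < 1 / 2"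
    by (auto simp: eventually_sequentially)
  show "summable f"
  proof (rule summable_ratio_test)
    fix j assume "j \<ge> N"
    have "f (Suc j) = (norm p ^ Suc j * (1 + norm w)) * f j"
      by (simp only: f_def choose_two_Suc[of "Suc j"] power_add power_Suc mult_ac)
    also have "\<dots> \<le> 1 / 2 * f j"
      using N[OF \<open>j \<ge> N\<close>] by (intro mult_right_mono) (auto simp: f_def)
    finally show "norm (f (Suc j)) \<le> 1 / 2 * norm (f j)"
      by (simp add: f_def abs_mult)
  qed simp
  show "norm (norm (p ^ (Suc j choose 2) * jtp_coeff w j)) \<le> f j" for j
    using jtp_coeff_bound[of w j] by (simp add: f_def norm_mult norm_power mult_left_mono)
qed

text \<open>For fixed j both reciprocals tend to 1 / (q)_inf, and they are uniformly bounded, so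
  Tannery's theorem applies.\<close>

lemma Bailey_pair_tendsto:
  assumes q: "norm q < 1" and \<alpha>: "summable (\<lambda>j. norm (\<alpha> j))"
  shows "(\<lambda>m. \<Sum>j\<le>m. \<alpha> j / (qpoch q q (m - j) * qpoch q q (m + j + 1)))
           \<longlonglongrightarrow> (\<Sum>j. \<alpha> j) / (qpoch_inf q q)\<^sup>2"
proof -
  obtain M where M: "\<And>m. norm (1 / qpoch q q m) \<le> M"
    using inverse_qpoch_bounded[OF q] by blast
  have "M \<ge> 0"
    using order_trans[OF norm_ge_zero M] .
  have "(\<lambda>m. \<Sum>j\<le>m. \<alpha> j * (1 / qpoch q q (m - j) * (1 / qpoch q q (m + j + 1))))
      \<longlonglongrightarrow> (\<Sum>j. \<alpha> j) * (1 / qpoch_inf q q * (1 / qpoch_inf q q))"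
  proof (rule tendsto_sum_Tannery[OF \<alpha>])
    show "norm (1 / qpoch q q (m - j) * (1 / qpoch q q (m + j + 1))) \<le> M * M" for m j
      unfolding norm_mult using M \<open>M \<ge> 0\<close> by (intro mult_mono) auto
    fix j
    have "(\<lambda>m. qpoch q q (m - j)) \<longlonglongrightarrow> qpoch_inf q q"
      by (rule filterlim_compose[OF qpoch_tendsto[OF q] filterlim_minus_const_nat_at_top])
    moreover have "(\<lambda>m. qpoch q q (m + (j + 1))) \<longlonglongrightarrow> qpoch_inf q q"
      by (rule LIMSEQ_ignore_initial_segment[OF qpoch_tendsto[OF q]])
    ultimately show "(\<lambda>m. 1 / qpoch q q (m - j) * (1 / qpoch q q (m + j + 1)))
        \<longlonglongrightarrow> 1 / qpoch_inf q q * (1 / qpoch_inf q q)"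
      using qpoch_inf_self_nonzero[OF q] by (auto intro!: tendsto_intros simp: add.assoc)
  qed
  then show ?thesis
    by (simp add: power2_eq_square)
qed

text \<open>Let n tend to infinity in the finite version. The product side acquires 1 / (p)_inf and
  the series side 1 / (p)_inf^2, which leaves the factor (p)_inf.\<close>

lemma Jacobi_triple_product:
  assumes p: "norm p < 1" and "z \<noteq> 0"
  shows "(\<Sum>j. p ^ (Suc j choose 2) * jtp_coeff (z + 1 / z) j)
       = qpoch_inf (- p / z) p * qpoch_inf (- z * p) p * qpoch_inf p p"
proof -
  have "(\<lambda>n. qpoch p p (2 * n + 1)) \<longlonglongrightarrow> qpoch_inf p p"
    by (rule filterlim_compose[OF qpoch_tendsto[OF p] filterlim_subseq]) (simp add: strict_mono_def)
  then have "(\<lambda>n. qpoch (- p / z) p n * qpoch (- z * p) p n / qpoch p p (2 * n + 1))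
      \<longlonglongrightarrow> qpoch_inf (- p / z) p * qpoch_inf (- z * p) p / qpoch_inf p p"
    by (intro tendsto_intros qpoch_tendsto qpoch_inf_self_nonzero p)
  moreover have "(\<lambda>n. qpoch (- p / z) p n * qpoch (- z * p) p n / qpoch p p (2 * n + 1))
      \<longlonglongrightarrow> (\<Sum>j. p ^ (Suc j choose 2) * jtp_coeff (z + 1 / z) j) / (qpoch_inf p p)\<^sup>2"
    unfolding finite_Jacobi_triple_product[OF assms]
    by (rule Bailey_pair_tendsto[OF p summable_theta[OF p]])
  ultimately have "qpoch_inf (- p / z) p * qpoch_inf (- z * p) p / qpoch_inf p p
      = (\<Sum>j. p ^ (Suc j choose 2) * jtp_coeff (z + 1 / z) j) / (qpoch_inf p p)\<^sup>2"
    by (rule LIMSEQ_unique)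
  then show ?thesis
    using qpoch_inf_self_nonzero[OF p] by (simp add: field_simps power2_eq_square)
qed

section \<open>Evaluation of the multiple sum\<close>

lemma Bailey_chain_sum:
  assumes q: "norm q < 1" and \<alpha>: "summable (\<lambda>j. norm (\<alpha> j))"
    and c: "\<And>m. c m = qpoch (- q) q m * (\<Sum>j\<le>m. \<alpha> j / (qpoch q q (m - j) * qpoch q q (m + j + 1)))"
  shows "((\<lambda>n. c (n (Suc k)) * q ^ (\<Sum>i=1..Suc k. Suc (n i) choose 2)
             / (\<Prod>i=1..<Suc k. qpoch q q (n i - n (Suc i))))
          has_sum (qpoch_inf (- q) q * (\<Sum>j. q ^ (Suc k * (Suc j choose 2)) * \<alpha> j) / qpoch_inf q q))
         (decr_tuples (Suc k))" (is "(?f has_sum ?S) _")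
proof -
  obtain M where M: "\<And>m. norm (1 / qpoch q q m) \<le> M"
    using inverse_qpoch_bounded[OF q] by blast
  define T where "T k = (Bailey_op q ^^ k) c" for k
  \<comment> \<open>Needed at 0 and k for bounds, and at k + 1 for the value of the sum.\<close>
  have T_lim: "T k \<longlonglongrightarrow> qpoch_inf (- q) q * ((\<Sum>j. q ^ (k * (Suc j choose 2)) * \<alpha> j) / (qpoch_inf q q)\<^sup>2)" for k
  proof -
    have "summable (\<lambda>j. norm (q ^ (k * (Suc j choose 2)) * \<alpha> j))"
      by (rule summable_comparison_test'[OF \<alpha>, of 0])
         (use q in \<open>auto simp: norm_mult norm_power intro!: mult_left_le_one_le power_le_one\<close>)
    then show ?thesis
      unfolding T_def Bailey_op_funpow[OF q c, abs_def]
      by (intro tendsto_intros qpoch_tendsto Bailey_pair_tendsto q)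
  qed
  have T_bounded: "\<exists>C. \<forall>m. norm (T k m) \<le> C" for k
    using convergent_imp_Bseq[OF convergentI[OF T_lim[of k]]] by (auto simp: Bseq_def)
  obtain C0 where C0: "\<And>m. norm (c m) \<le> C0"
    using T_bounded[of 0] by (auto simp: T_def)
  obtain C where C: "\<And>m. norm (T k m) \<le> C"
    using T_bounded[of k] by blast
  define a where "a r = q ^ (Suc r choose 2) * T k r" for r
  have a: "summable (\<lambda>r. norm (a r))"
  proof (rule summable_comparison_test')
    show "summable (\<lambda>r. norm q ^ r * C)"
      using q by (intro summable_mult2 summable_geometric) auto
    show "norm (norm (a r)) \<le> norm q ^ r * C" for r
      unfolding real_norm_def abs_norm_cancel unfolding a_def norm_mult norm_power
      using q C by (intro mult_mono power_decreasing) (auto simp: numeral_2_eq_2)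
  qed
  \<comment> \<open>The outermost sum lacks the weight 1 / (q)_{N-r} of \<open>Bailey_op\<close>.
    This weight tends to 1 / (q)_inf, so comparing the limit with \<open>T_lim\<close> evaluates the
    unweighted sum and cancels one power of (q)_inf.\<close>
  have "(\<lambda>N. \<Sum>r\<le>N. a r * (1 / qpoch q q (N - r))) \<longlonglongrightarrow> (\<Sum>r. a r) * (1 / qpoch_inf q q)"
  proof (rule tendsto_sum_Tannery[OF a M])
    show "(\<lambda>N. 1 / qpoch q q (N - r)) \<longlonglongrightarrow> 1 / qpoch_inf q q" for r
      by (intro tendsto_intros qpoch_inf_self_nonzero q
          filterlim_compose[OF qpoch_tendsto[OF q] filterlim_minus_const_nat_at_top])
  qed
  also have "(\<lambda>N. \<Sum>r\<le>N. a r * (1 / qpoch q q (N - r))) = T (Suc k)"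
    by (simp add: T_def a_def Bailey_op_def fun_eq_iff)
  finally have "(\<Sum>r. a r) * (1 / qpoch_inf q q)
      = qpoch_inf (- q) q * ((\<Sum>j. q ^ (Suc k * (Suc j choose 2)) * \<alpha> j) / (qpoch_inf q q)\<^sup>2)"
    using LIMSEQ_unique T_lim by blast
  then have a_sum: "(\<Sum>r. a r) = ?S"
    using qpoch_inf_self_nonzero[OF q] by (simp add: field_simps power2_eq_square)
  have "(\<lambda>N. \<Sum>r\<le>N. a r) \<longlonglongrightarrow> ?S"
    unfolding a_sum[symmetric] using summable_LIMSEQ'[OF summable_norm_cancel[OF a]] .
  then have lim: "(\<lambda>N. sum ?f {n \<in> decr_tuples (Suc k). n 1 \<le> N}) \<longlonglongrightarrow> ?S"
    unfolding sum_decr_tuples a_def T_def .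
  \<comment> \<open>Summability provides some value \<open>S\<close>; the limit along the
    truncations identifies it.\<close>
  have "?f summable_on decr_tuples (Suc k)"
    by (rule summable_on_decr_tuples[OF q C0 M])
  then obtain S where S: "(?f has_sum S) (decr_tuples (Suc k))"
    by (auto simp: summable_on_def)
  have "(\<lambda>N. sum ?f {n \<in> decr_tuples (Suc k). n 1 \<le> N}) \<longlonglongrightarrow> S"
    using filterlim_compose[OF S[unfolded has_sum_def] filterlim_decr_tuples] .
  then show ?thesis
    using S LIMSEQ_unique[OF lim] by simp
qed

theorem theorem5p3:
  fixes k :: nat and q z :: complex
  assumes "k \<ge> 1" and "norm q < 1" and "z \<noteq> 0"
  shows "((\<lambda>n. qpochs [- q / z, - z * q, - q] q (n k) * q ^ (\<Sum>i=1..k. (n i + 1) choose 2)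
             / ((\<Prod>i=1..<k. qpoch q q (n i - n (i + 1))) * qpoch q q (2 * n k + 1)))
          has_sum
            (qpoch_inf (- q) q
             * qpochs_inf [- (q ^ (k + 1)) / z, - z * q ^ (k + 1), q ^ (k + 1)] (q ^ (k + 1))
             / qpoch_inf q q))
         (decr_tuples k)"
proof -
  define p where "p = q ^ (k + 1)"
  define \<alpha> where "\<alpha> j = q ^ (Suc j choose 2) * jtp_coeff (z + 1 / z) j" for j
  define c where "c m = qpochs [- q / z, - z * q, - q] q m / qpoch q q (2 * m + 1)" for m
  have p: "norm p < 1"
    using power_less_one_iff[of "norm q" "k + 1"] \<open>norm q < 1\<close> by (simp add: p_def norm_power del: power_Suc)
  have c: "c m = qpoch (- q) q m * (\<Sum>j\<le>m. \<alpha> j / (qpoch q q (m - j) * qpoch q q (m + j + 1)))" for m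
    unfolding c_def \<alpha>_def finite_Jacobi_triple_product[OF assms(2,3), symmetric]
    by (simp add: qpochs_def)
  \<comment> \<open>The k powers from the chain and the one already in \<open>\<alpha> j\<close>
    produce the base q^(k+1).\<close>
  have "q ^ (k * (Suc j choose 2)) * \<alpha> j = p ^ (Suc j choose 2) * jtp_coeff (z + 1 / z) j" for j
    by (simp add: \<alpha>_def p_def power_add power_mult_distrib flip: power_mult)
  then have theta: "(\<Sum>j. q ^ (k * (Suc j choose 2)) * \<alpha> j)
      = qpoch_inf (- p / z) p * qpoch_inf (- z * p) p * qpoch_inf p p"
    using Jacobi_triple_product[OF p \<open>z \<noteq> 0\<close>] by simp
  have \<alpha>: "summable (\<lambda>j. norm (\<alpha> j))"
    unfolding \<alpha>_def by (rule summable_theta[OF assms(2)])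
  obtain k' where k: "k = Suc k'"
    using \<open>k \<ge> 1\<close> by (cases k) auto
  show ?thesis
    using Bailey_chain_sum[OF assms(2) \<alpha> c, of k', folded k] unfolding theta
    by (simp add: c_def qpochs_inf_def p_def mult_ac)
qed

end
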